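(* Let $G=(V,D,B)$ be a mixed graph such that every family $(Y_v : v\in V)$ of subsets of $V$ either contains a set $Y_v$ that does not satisfy the half-trek criterion with respect to $v$, or contains a pair $Y_v,Y_w$ with $v\in Y_w$ and $w\in Y_v$. Then $\phi_G$ is generically infinite-to-one.
   Context: A mixed graph is a triple $G=(V,D,B)$ with $V=[m]$, $D\subseteq V\times V$ a set of directed edges $v\to w$, and $B$ a symmetric set of bidirected edges $v\leftrightarrow w$; no self-loops. $\mathrm{pa}(v)=\{w: w\to v\in D\}$, $\mathrm{sib}(v)=\{w : w\leftrightarrow v\in B\}$. $\mathbb{R}^D_{\mathrm{reg}}$ is the set of real $m\times m$ matrices $\Lambda$ with $\lambda_{vw}=0$ whenever $v\to w\notin D$ and $I-\Lambda$ invertible; $\mathrm{PD}(B)$ the positive definite symmetric $\Omega$ with $\omega_{vw}=0$ whenever $v\ne w$, $v\leftrightarrow w\notin B$; $\Theta=\mathbb{R}^D_{\mathrm{reg}}\times\mathrm{PD}(B)$; $\phi_G(\Lambda,\Omega)=(I-\Lambda)^{-T}\Omega(I-\Lambda)^{-1}$. A proper algebraic subset of $\Theta$ is the zero set in $\Theta$ of some polynomials in the entries of $(\Lambda,\Omega)$, not equal to $\Theta$. $\phi_G$ is generically infinite-to-one if the fiber $\{(\Lambda',\Omega')\in\Theta:\phi_G(\Lambda',\Omega')=\phi_G(\Lambda,\Omega)\}$ is infinite for all $(\Lambda,\Omega)$ outside a proper algebraic subset of $\Theta$. Treks: a path is a sequence of edges of $D\cup B$ connecting consecutive nodes (not necessarily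 simple, directed edges traversable either way). A half-trek from $v$ to $w$ is a path of the form $v\leftrightarrow w_0\to w_1\to\cdots\to w_r=w$ (left side $\{v\}$, right side $\{w_0,\dots,w_r\}$) or $v\to w_1\to\cdots\to w_r=w$ with $r\ge0$ (left side $\{v\}$, right side $\{v,w_1,\dots,w_r\}$). A system of half-treks from $X$ to $Y$ is a set of $|X|=|Y|$ half-treks whose sources are exactly the distinct elements of $X$ and targets exactly the distinct elements of $Y$; it has no sided intersection if the left sides are pairwise disjoint and the right sides are pairwise disjoint. A set $Y\subseteq V$ satisfies the half-trek criterion with respect to $v$ if (i) $|Y|=|\mathrm{pa}(v)|$, (ii) $Y\cap(\{v\}\cup\mathrm{sib}(v))=\emptyset$, (iii) there is a system of half-treks with no sided intersection from $Y$ to $\mathrm{pa}(v)$. *)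

theory Defs
  imports "HOL-Analysis.Analysis"
begin

text \<open>Mixed graphs on a finite vertex type 'v (playing the role of V = [m]).
  D and B are sets of ordered pairs; (v,w) \<in> D means v \<rightarrow> w,
  (v,w) \<in> B means v \<leftrightarrow> w.\<close>

definition mixed_graph :: "('v \<times> 'v) set \<Rightarrow> ('v \<times> 'v) set \<Rightarrow> bool" where
  "mixed_graph D B \<longleftrightarrow> sym B \<and> (\<forall>v. (v,v) \<notin> D) \<and> (\<forall>v. (v,v) \<notin> B)"

definition pa :: "('v \<times> 'v) set \<Rightarrow> 'v \<Rightarrow> 'v set" where
  "pa D v = {w. (w,v) \<in> D}"

definition sib :: "('v \<times> 'v) set \<Rightarrow> 'v \<Rightarrow> 'v set" where
  "sib B v = {w. (w,v) \<in> B}"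

definition directed_walk :: "('v \<times> 'v) set \<Rightarrow> 'v list \<Rightarrow> bool" where
  "directed_walk D ws \<longleftrightarrow> ws \<noteq> [] \<and> (\<forall>i. Suc i < length ws \<longrightarrow> (ws!i, ws!Suc i) \<in> D)"

text \<open>A half-trek from v to w with right side list ws: either
  v \<leftrightarrow> w0 \<rightarrow> ... \<rightarrow> wr = w with ws = [w0,...,wr], or
  v \<rightarrow> w1 \<rightarrow> ... \<rightarrow> wr = w (r \<ge> 0) with ws = [v,w1,...,wr].
  Its left side is {v} and its right side is set ws.\<close>
definition half_trek :: "('v \<times> 'v) set \<Rightarrow> ('v \<times> 'v) set \<Rightarrow> 'v \<Rightarrow> 'v \<Rightarrow> 'v list \<Rightarrow> bool" where
  "half_trek D B v w ws \<longleftrightarrow> directed_walk D ws \<and> last ws = w \<and>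
     ((v, hd ws) \<in> B \<or> hd ws = v)"

definition system_no_sided_intersection ::
  "('v \<times> 'v) set \<Rightarrow> ('v \<times> 'v) set \<Rightarrow> 'v set \<Rightarrow> 'v set \<Rightarrow> bool" where
  "system_no_sided_intersection D B X Y \<longleftrightarrow>
     (\<exists>(\<sigma>::'v \<Rightarrow> 'v) (\<pi>::'v \<Rightarrow> 'v list).
        bij_betw \<sigma> X Y \<and>
        (\<forall>x\<in>X. half_trek D B x (\<sigma> x) (\<pi> x)) \<and>
        (\<forall>x\<in>X. \<forall>x'\<in>X. x \<noteq> x' \<longrightarrow> {x} \<inter> {x'} = {} \<and> set (\<pi> x) \<inter> set (\<pi> x') = {}))"

definition HTC :: "('v \<times> 'v) set \<Rightarrow> ('v \<times> 'v) set \<Rightarrow> 'v set \<Rightarrow> 'v \<Rightarrow> bool" where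
  "HTC D B Y v \<longleftrightarrow> card Y = card (pa D v) \<and> Y \<inter> ({v} \<union> sib B v) = {} \<and>
     system_no_sided_intersection D B Y (pa D v)"

definition pos_def_mat :: "real^'v^'v \<Rightarrow> bool" where
  "pos_def_mat A \<longleftrightarrow> transpose A = A \<and> (\<forall>x. x \<noteq> 0 \<longrightarrow> x \<bullet> (A *v x) > 0)"

definition Theta :: "('v::finite \<times> 'v) set \<Rightarrow> ('v \<times> 'v) set \<Rightarrow> ((real^'v^'v) \<times> (real^'v^'v)) set" where
  "Theta D B = {(\<Lambda>, \<Omega>).
      (\<forall>v w. (v,w) \<notin> D \<longrightarrow> \<Lambda> $ v $ w = 0) \<and> invertible (mat 1 - \<Lambda>) \<and>
      pos_def_mat \<Omega> \<and> (\<forall>v w. v \<noteq> w \<and> (v,w) \<notin> B \<longrightarrow> \<Omega> $ v $ w = 0)}"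

definition phi :: "(real^'v::finite^'v) \<times> (real^'v^'v) \<Rightarrow> real^'v^'v" where
  "phi p = (case p of (\<Lambda>, \<Omega>) \<Rightarrow>
      transpose (matrix_inv (mat 1 - \<Lambda>)) ** \<Omega> ** matrix_inv (mat 1 - \<Lambda>))"

inductive_set poly_fun :: "((real^'v^'v) \<times> (real^'v^'v) \<Rightarrow> real) set" where
  const: "(\<lambda>_. c) \<in> poly_fun"
| lam: "(\<lambda>(\<Lambda>, \<Omega>). \<Lambda> $ i $ j) \<in> poly_fun"
| om: "(\<lambda>(\<Lambda>, \<Omega>). \<Omega> $ i $ j) \<in> poly_fun"
| add: "f \<in> poly_fun \<Longrightarrow> g \<in> poly_fun \<Longrightarrow> (\<lambda>x. f x + g x) \<in> poly_fun"
| mult: "f \<in> poly_fun \<Longrightarrow> g \<in> poly_fun \<Longrightarrow> (\<lambda>x. f x * g x) \<in> poly_fun"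

definition generically_infinite_to_one ::
  "('v::finite \<times> 'v) set \<Rightarrow> ('v \<times> 'v) set \<Rightarrow> bool" where
  "generically_infinite_to_one D B \<longleftrightarrow>
     (\<exists>P \<subseteq> poly_fun.
        {\<theta> \<in> Theta D B. \<forall>p\<in>P. p \<theta> = 0} \<noteq> Theta D B \<and>
        (\<forall>\<theta> \<in> Theta D B. \<not> (\<forall>p\<in>P. p \<theta> = 0) \<longrightarrow>
           infinite {\<theta>' \<in> Theta D B. phi \<theta>' = phi \<theta>}))"

end

(* Write L = I - Lambda. Deforming L to L (I + eps G) and Omega to (I + eps G)^T Omega (I + eps G)
   does not change phi, so a matrix G for which (-L G, Omega G + G^T Omega) has the zero pattern
   of Theta gives a direction along which phi is stationary.

   This is a linear system for G with polynomial coefficients. If it had only the zero solution over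
   the polynomials, one could assign to the unknowns G_kv pairwise distinct equations in which they
   occur. Starting at p in pa(v) and iterating this assignment on the unknowns G_kv, one follows
   directed edges backwards to some G_kv whose equation is the {u,v}-entry of Omega G + G^T Omega, with
   u = k or u <-> k: this is a half-trek from u to p. Injectivity makes the half-treks for a fixed v disjoint, and it
   prevents {u,v} from being used both for u and for v, contrary to the assumption.

   So there is a nonzero polynomial solution G, and wherever G does not vanish the vector field
   (-L G, Omega G + G^T Omega) has a nonconstant integral curve, which stays in a fibre of phi. *)

theory Submission
  imports Defs
begin

subsection \<open>Linear systems over a ring of functions\<close>

text \<open>Functions in \<open>F\<close>, identified when they agree on \<open>S\<close>, form an
  integral domain by \<open>dom\<close>. The induction removes the row \<open>i0\<close> together
  with one candidate column at a time. If no transversal arises, one of the kernel vectors from the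
  induction hypothesis already works, or jointly they eliminate the row \<open>i0\<close>; this
  replaces a determinant argument.\<close>

lemma kernel_or_transversal:
  fixes F :: "('e \<Rightarrow> real) set" and M :: "'i \<Rightarrow> 'j \<Rightarrow> 'e \<Rightarrow> real"
  assumes const: "\<And>c. (\<lambda>_. c) \<in> F"
    and add: "\<And>f g. f \<in> F \<Longrightarrow> g \<in> F \<Longrightarrow> (\<lambda>x. f x + g x) \<in> F"
    and mult: "\<And>f g. f \<in> F \<Longrightarrow> g \<in> F \<Longrightarrow> (\<lambda>x. f x * g x) \<in> F"
    and "S \<noteq> {}"
    and dom: "\<And>f g. f \<in> F \<Longrightarrow> g \<in> F \<Longrightarrow> \<exists>x\<in>S. f x \<noteq> 0 \<Longrightarrow> \<exists>x\<in>S. g x \<noteq> 0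
                \<Longrightarrow> \<exists>x\<in>S. f x * g x \<noteq> 0"
    and M: "\<And>i j. M i j \<in> F"
    and "finite I" "finite J"
  shows "(\<exists>\<tau>. inj_on \<tau> I \<and> (\<forall>i\<in>I. \<tau> i \<in> J \<and> (\<exists>x\<in>S. M i (\<tau> i) x \<noteq> 0))) \<or>
    (\<exists>c. (\<forall>i. c i \<in> F) \<and> (\<exists>i\<in>I. \<exists>x\<in>S. c i x \<noteq> 0) \<and>
       (\<forall>j\<in>J. \<forall>x\<in>S. (\<Sum>i\<in>I. c i x * M i j x) = 0))"
  using \<open>finite I\<close> \<open>finite J\<close>
proof (induction I arbitrary: J rule: finite_induct)
  case empty
  then show ?case by simp
next
  case (insert i0 I)
  have sum_F: "(\<lambda>x. \<Sum>k\<in>K. f k x) \<in> F" if "\<And>k. f k \<in> F" for K :: "'k set" and f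
  proof (induction K rule: infinite_finite_induct)
    case (insert k K)
    then show ?case using add[OF that insert.IH, of k] by simp
  qed (use const in auto)
  have prod_F: "(\<lambda>x. \<Prod>k\<in>K. f k x) \<in> F" if "\<And>k. f k \<in> F" for K :: "'k set" and f
  proof (induction K rule: infinite_finite_induct)
    case (insert k K)
    then show ?case using mult[OF that insert.IH, of k] by simp
  qed (use const in auto)
  have prod_nz: "\<exists>x\<in>S. (\<Prod>k\<in>K. f k x) \<noteq> 0"
    if "finite K" "\<And>k. f k \<in> F" "\<And>k. k \<in> K \<Longrightarrow> \<exists>x\<in>S. f k x \<noteq> 0" for K :: "'k set" and f
    using that(1,3)
  proof (induction K rule: finite_induct)
    case empty
    then show ?case using \<open>S \<noteq> {}\<close> by auto
  next
    case (insert k K)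
    have "\<exists>x\<in>S. f k x * (\<Prod>k\<in>K. f k x) \<noteq> 0"
      using insert prod_F[OF that(2)] that(2) by (intro dom) auto
    then show ?case using insert by simp
  qed
  \<comment> \<open>The columns available to row \<open>i0\<close>. If there are none, the
    construction below ends with the \<open>i0\<close>-th unit vector, since \<open>p\<close> is
    then the empty product.\<close>
  define K where "K = {j\<in>J. \<exists>x\<in>S. M i0 j x \<noteq> 0}"
  have finK: "finite K" using insert.prems by (simp add: K_def)
  show ?case
  proof (cases "\<exists>j\<in>K. \<exists>\<tau>. inj_on \<tau> I \<and> (\<forall>i\<in>I. \<tau> i \<in> J - {j} \<and> (\<exists>x\<in>S. M i (\<tau> i) x \<noteq> 0))")
    case True
    then obtain j \<tau> where j: "j \<in> K"
      and \<tau>: "inj_on \<tau> I" "\<forall>i\<in>I. \<tau> i \<in> J - {j} \<and> (\<exists>x\<in>S. M i (\<tau> i) x \<noteq> 0)" by blast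
    define \<tau>' where "\<tau>' = \<tau>(i0 := j)"
    have "inj_on \<tau>' (insert i0 I)"
      using \<tau> insert.hyps by (auto simp: \<tau>'_def inj_on_def)
    moreover have "\<forall>i\<in>insert i0 I. \<tau>' i \<in> J \<and> (\<exists>x\<in>S. M i (\<tau>' i) x \<noteq> 0)"
      using \<tau> j insert.hyps by (auto simp: \<tau>'_def K_def)
    ultimately show ?thesis by blast
  next
    case False
    let ?ker = "\<lambda>j c. (\<forall>i. c i \<in> F) \<and> (\<exists>i\<in>I. \<exists>x\<in>S. c i x \<noteq> 0) \<and>
       (\<forall>j'\<in>J - {j}. \<forall>x\<in>S. (\<Sum>i\<in>I. c i x * M i j' x) = 0)"
    have "\<exists>c. ?ker j c" if "j \<in> K" for j
    proof -
      have "finite (J - {j})" using insert.prems by simp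
      from insert.IH[OF this] show ?thesis using False that by blast
    qed
    moreover define c where "c j = (SOME c. ?ker j c)" for j
    ultimately have ker: "?ker j (c j)" if "j \<in> K" for j
      using someI_ex[of "?ker j"] that by auto
    have cF: "c j i \<in> F" if "j \<in> K" for j i
      using ker[OF that] by blast
    have cnz: "\<exists>i\<in>I. \<exists>x\<in>S. c j i x \<noteq> 0" if "j \<in> K" for j
      using ker[OF that] by blast
    have ck: "(\<Sum>i\<in>I. c j i x * M i j' x) = 0"
      if "j \<in> K" "j' \<in> J" "j' \<noteq> j" "x \<in> S" for j j' x
      using ker[OF that(1)] that(2-4) by blast
    \<comment> \<open>Zero outside \<open>K\<close> puts \<open>b j i\<close> in \<open>F\<close>
      for every \<open>j\<close>, as \<open>sum_F\<close> requires of the whole family.\<close>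
    define b where "b j i = (if j \<in> K then c j i else (\<lambda>_. 0))" for j i
    have bF: "b j i \<in> F" for i j using cF const by (simp add: b_def)
    define \<alpha> where "\<alpha> j = (\<lambda>x. \<Sum>i\<in>I. b j i x * M i j x)" for j
    have \<alpha>F: "\<alpha> j \<in> F" for j
      unfolding \<alpha>_def using bF M mult by (intro sum_F) auto
    show ?thesis
    proof (cases "\<exists>j\<in>K. \<forall>x\<in>S. \<alpha> j x = 0")
      case True
      then obtain j where j: "j \<in> K" "\<forall>x\<in>S. \<alpha> j x = 0" by blast
      \<comment> \<open>If \<open>\<alpha> j\<close> vanishes on \<open>S\<close>, then
        \<open>c j\<close> also annihilates the one column \<open>j\<close> that the induction
        hypothesis left out.\<close>
      define c' where "c' = (c j)(i0 := (\<lambda>_. 0))"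
      have "(\<Sum>i\<in>insert i0 I. c' i x * M i j' x) = 0" if "j' \<in> J" "x \<in> S" for j' x
      proof -
        have "(\<Sum>i\<in>insert i0 I. c' i x * M i j' x) = (\<Sum>i\<in>I. c j i x * M i j' x)"
          using insert.hyps by (auto simp: c'_def intro!: sum.cong)
        also have "\<dots> = 0"
          using j ck[OF j(1) that(1) _ that(2)] that by (cases "j' = j") (auto simp: \<alpha>_def b_def)
        finally show ?thesis .
      qed
      moreover have "\<forall>i. c' i \<in> F" using cF j const by (simp add: c'_def)
      moreover have "\<exists>i\<in>insert i0 I. \<exists>x\<in>S. c' i x \<noteq> 0"
      proof -
        obtain i x where "i \<in> I" "x \<in> S" "c j i x \<noteq> 0" using cnz[OF j(1)] by blast
        then have "c' i x \<noteq> 0" using insert.hyps by (auto simp: c'_def)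
        then show ?thesis using \<open>i \<in> I\<close> \<open>x \<in> S\<close> by blast
      qed
      ultimately show ?thesis by blast
    next
      case False
      text \<open>The vector \<open>c j\<close> combines the rows in \<open>I\<close> to \<open>\<alpha> j\<close> times the \<open>j\<close>-th unit row, so
        row \<open>i0\<close>, scaled by the product of all \<open>\<alpha> j\<close>, is a combination of the rows in \<open>I\<close>.\<close>
      define p where "p = (\<lambda>x. \<Prod>j\<in>K. \<alpha> j x)"
      define q where "q j = (\<lambda>x. \<Prod>j'\<in>K - {j}. \<alpha> j' x)" for j
      define c' where "c' i = (if i = i0 then p
         else (\<lambda>x. \<Sum>j\<in>K. - 1 * (q j x * (M i0 j x * b j i x))))" for i
      have pF: "p \<in> F" unfolding p_def by (rule prod_F) (rule \<alpha>F)
      have qF: "q j \<in> F" for j unfolding q_def by (rule prod_F) (rule \<alpha>F)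
      have "(\<lambda>x. \<Sum>j\<in>K. - 1 * (q j x * (M i0 j x * b j i x))) \<in> F" for i
        by (intro sum_F mult const qF M bF)
      then have c'F: "c' i \<in> F" for i
        using pF by (cases "i = i0") (simp_all only: c'_def if_True if_False refl)
      have "\<exists>x\<in>S. p x \<noteq> 0"
        unfolding p_def using False finK \<alpha>F by (intro prod_nz) auto
      then have nz: "\<exists>i\<in>insert i0 I. \<exists>x\<in>S. c' i x \<noteq> 0" by (auto simp: c'_def)
      have "(\<Sum>i\<in>insert i0 I. c' i x * M i j' x) = 0" if "j' \<in> J" "x \<in> S" for j' x
      proof -
        have "(\<Sum>i\<in>I. c' i x * M i j' x) =
            (\<Sum>i\<in>I. \<Sum>j\<in>K. - (q j x * M i0 j x * (b j i x * M i j' x)))"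
          using insert.hyps
          by (intro sum.cong refl) (auto simp: c'_def sum_distrib_right mult.assoc)
        also have "\<dots> = (\<Sum>j\<in>K. - (q j x * M i0 j x * (\<Sum>i\<in>I. b j i x * M i j' x)))"
          by (subst sum.swap) (simp add: sum_distrib_left sum_negf)
        \<comment> \<open>\<open>c j\<close> annihilates every column of \<open>J\<close> other than
          \<open>j\<close>, so only \<open>j = j'\<close> survives, where \<open>\<alpha> j\<close>
          restores the factor missing from \<open>q j\<close>.\<close>
        also have "\<dots> = (\<Sum>j\<in>K. if j = j' then - (p x * M i0 j' x) else 0)"
        proof (intro sum.cong refl)
          fix j assume j: "j \<in> K"
          show "- (q j x * M i0 j x * (\<Sum>i\<in>I. b j i x * M i j' x)) =
            (if j = j' then - (p x * M i0 j' x) else 0)"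
          proof (cases "j = j'")
            case True
            have "p x = \<alpha> j x * q j x"
              unfolding p_def q_def using finK j by (rule prod.remove)
            then show ?thesis using True by (simp add: \<alpha>_def)
          next
            case False
            then show ?thesis using ck[OF j that(1) _ that(2)] j by (simp add: b_def)
          qed
        qed
        \<comment> \<open>A column outside \<open>K\<close> gives zero on both sides, because row
          \<open>i0\<close> vanishes there on \<open>S\<close>.\<close>
        also have "\<dots> = - (p x * M i0 j' x)"
          using finK that by (auto simp: K_def sum.delta)
        finally show ?thesis using insert.hyps by (simp add: c'_def)
      qed
      then show ?thesis using c'F nz by blast
    qed
  qed
qed

subsection \<open>Half-treks from a transversal\<close>

text \<open>Two orbits that meet can be traced back by injectivity until one reaches its start;
  starts have no preimage, so both reach it at once. An endless orbit would therefore be injective,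
  which a finite type excludes.\<close>

lemma injective_partial_paths:
  fixes f :: "'a::finite \<Rightarrow> 'a option"
  assumes inj: "\<And>x y z. f x = Some z \<Longrightarrow> f y = Some z \<Longrightarrow> x = y"
    and A: "\<And>x p. p \<in> A \<Longrightarrow> f x \<noteq> Some p"
  obtains n :: "'a \<Rightarrow> nat" and x :: "'a \<Rightarrow> nat \<Rightarrow> 'a" where
    "\<And>p. x p 0 = p"
    "\<And>p i. p \<in> A \<Longrightarrow> i < n p \<Longrightarrow> f (x p i) = Some (x p (Suc i))"
    "\<And>p. p \<in> A \<Longrightarrow> f (x p (n p)) = None"
    "\<And>p q i j. \<lbrakk>p \<in> A; q \<in> A; i \<le> n p; j \<le> n q; x p i = x q j\<rbrakk> \<Longrightarrow> p = q \<and> i = j"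
proof -
  \<comment> \<open>\<open>the\<close> makes the orbit total; nothing is claimed about its values
    past the first \<open>None\<close>.\<close>
  define x where "x p i = ((\<lambda>k. the (f k)) ^^ i) p" for p i
  have x0: "x p 0 = p" for p by (simp add: x_def)
  have xS: "f (x p i) = Some (x p (Suc i))" if "f (x p i) \<noteq> None" for p i
    using that by (auto simp: x_def)
  have unique: "p = q \<and> i = j"
    if "p \<in> A" "q \<in> A" "\<forall>i'<i. f (x p i') \<noteq> None" "\<forall>j'<j. f (x q j') \<noteq> None" "x p i = x q j"
    for p q i j
    using that
  proof (induction i arbitrary: j)
    case 0
    show ?case
    proof (cases j)
      case (Suc j')
      then have "f (x q j') = Some p" using xS[of q j'] 0 x0 by auto
      then show ?thesis using A 0 by blast
    qed (use 0 x0 in auto)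
  next
    case (Suc i)
    have fi: "f (x p i) = Some (x p (Suc i))" using xS[of p i] Suc.prems by blast
    show ?case
    proof (cases j)
      case 0
      then show ?thesis using fi Suc.prems A x0 by metis
    next
      case (Suc j')
      then have "f (x q j') = Some (x p (Suc i))" using xS[of q j'] Suc.prems by auto
      then have "x p i = x q j'" using inj fi by blast
      then have "p = q \<and> i = j'" using Suc.IH[of j'] Suc.prems \<open>j = Suc j'\<close> by auto
      then show ?thesis using Suc by simp
    qed
  qed
  have ex: "\<exists>i. f (x p i) = None" if "p \<in> A" for p
  proof (rule ccontr)
    assume "\<nexists>i. f (x p i) = None"
    then have "inj (x p)" using unique[OF that that] by (auto simp: inj_def)
    then show False using finite_imageD[of "x p" UNIV] by simp
  qed
  define n where "n p = (LEAST i. f (x p i) = None)" for p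
  have before: "f (x p i) \<noteq> None" if "i < n p" for p i
    using that not_less_Least unfolding n_def by blast
  show thesis
  proof (rule that[of x n])
    show "f (x p (n p)) = None" if "p \<in> A" for p
      using LeastI_ex[OF ex[OF that]] by (simp add: n_def)
    show "p = q \<and> i = j" if "p \<in> A" "q \<in> A" "i \<le> n p" "j \<le> n q" "x p i = x q j" for p q i j
      using that before by (intro unique) auto
  qed (use x0 xS before in auto)
qed

text \<open>\<open>Inl\<close> equations link only unknowns with the same second index
  \<open>v\<close>, so each \<open>Y v\<close> is built separately. Different \<open>v\<close>
  interact only because \<open>{u,v}\<close> is a single equation that serves one unknown at
  most.\<close>

lemma transversal_imp_HTC_family:
  fixes D B :: "('v::finite \<times> 'v) set" and \<tau> :: "'v \<times> 'v \<Rightarrow> ('v \<times> 'v) + 'v set"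
  assumes "inj \<tau>"
    and Inl: "\<And>k v k' w. \<tau> (k,v) = Inl (k',w) \<Longrightarrow> w = v \<and> (k',v) \<notin> D \<and> (k' = k \<or> (k',k) \<in> D)"
    and Inr: "\<And>k v e. \<tau> (k,v) = Inr e \<Longrightarrow> \<exists>u. e = {u,v} \<and> u \<noteq> v \<and> (u,v) \<notin> B \<and> (u = k \<or> (u,k) \<in> B)"
  shows "\<exists>Y. (\<forall>v. HTC D B (Y v) v) \<and> (\<forall>v w. v \<noteq> w \<longrightarrow> v \<in> Y w \<longrightarrow> w \<notin> Y v)"
proof -
  have "\<exists>Y. HTC D B Y v \<and> (\<forall>u\<in>Y. \<exists>k. \<tau> (k,v) = Inr {u,v})" for v
  proof -
    \<comment> \<open>A chain step passes from \<open>k\<close> to \<open>k'\<close> as long as the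
      assigned equation is an \<open>Inl\<close>; \<open>None\<close> marks an \<open>Inr\<close>
      equation, which supplies the source of the half-trek.\<close>
    define f where "f k = (case \<tau> (k,v) of Inl (k',_) \<Rightarrow> Some k' | Inr _ \<Rightarrow> None)" for k
    have fS: "\<tau> (k,v) = Inl (z,v)" if "f k = Some z" for k z
      using that Inl by (auto simp: f_def split: sum.splits)
    have fN: "\<exists>e. \<tau> (k,v) = Inr e" if "f k = None" for k
      using that by (auto simp: f_def split: sum.splits)
    have inj: "y = z" if "f y = Some w" "f z = Some w" for y z w
      using fS[OF that(1)] fS[OF that(2)] \<open>inj \<tau>\<close> by (metis injD prod.inject)
    \<comment> \<open>\<open>Inl\<close> equations sit at non-edges only, so no chain step lands on
      a parent of \<open>v\<close>, and the parents can serve as starting points.\<close>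
    have pa: "f k \<noteq> Some p" if "p \<in> pa D v" for k p
      using that fS Inl by (fastforce simp: pa_def)
    obtain n x where x0: "\<And>p. x p 0 = p"
      and xS: "\<And>p i. p \<in> pa D v \<Longrightarrow> i < n p \<Longrightarrow> f (x p i) = Some (x p (Suc i))"
      and xN: "\<And>p. p \<in> pa D v \<Longrightarrow> f (x p (n p)) = None"
      and xinj: "\<And>p q i j. \<lbrakk>p \<in> pa D v; q \<in> pa D v; i \<le> n p; j \<le> n q; x p i = x q j\<rbrakk>
                  \<Longrightarrow> p = q \<and> i = j"
      by (rule injective_partial_paths[of f "pa D v"]) (rule inj, assumption, assumption, rule pa, assumption, blast)
    have "\<exists>u. \<tau> (x p (n p), v) = Inr {u,v} \<and> u \<noteq> v \<and> (u,v) \<notin> B \<and> (u = x p (n p) \<or> (u, x p (n p)) \<in> B)"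
      if "p \<in> pa D v" for p
      using fN[OF xN[OF that]] Inr by fastforce
    then obtain u where u: "\<And>p. p \<in> pa D v \<Longrightarrow> \<tau> (x p (n p), v) = Inr {u p,v} \<and> u p \<noteq> v \<and>
        (u p,v) \<notin> B \<and> (u p = x p (n p) \<or> (u p, x p (n p)) \<in> B)"
      by metis
    have "inj_on u (pa D v)"
    proof (rule inj_onI)
      fix p q assume pq: "p \<in> pa D v" "q \<in> pa D v" "u p = u q"
      then have "x p (n p) = x q (n q)"
        using u[of p] u[of q] \<open>inj \<tau>\<close> by (metis injD prod.inject)
      then show "p = q" using xinj pq by blast
    qed
    \<comment> \<open>The chain runs against the edges from the parent \<open>p\<close>, hence the
      reversal.\<close>
    define w where "w p = rev (map (x p) [0..<Suc (n p)])" for p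
    have len: "length (w p) = Suc (n p)" for p by (simp add: w_def)
    have nth: "w p ! i = x p (n p - i)" if "i \<le> n p" for p i
      using that by (simp add: w_def rev_nth del: upt_Suc)
    have set: "set (w p) = x p ` {..n p}" for p
      by (auto simp: w_def simp del: upt_Suc)
    have half_trek: "half_trek D B (u p) p (w p)" if p: "p \<in> pa D v" for p
    proof -
      have "(w p ! i, w p ! Suc i) \<in> D" if "Suc i < length (w p)" for i
      proof -
        define j where "j = n p - Suc i"
        have j: "j < n p" "n p - i = Suc j" using that by (auto simp: j_def len)
        have "\<tau> (x p j, v) = Inl (x p (Suc j), v)" using fS[OF xS[OF p j(1)]] .
        then have "x p (Suc j) = x p j \<or> (x p (Suc j), x p j) \<in> D" using Inl by blast
        \<comment> \<open>A stationary step, the case \<open>k' = k\<close>, would repeat a point of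
          the orbit.\<close>
        moreover have "x p (Suc j) \<noteq> x p j" using xinj[OF p p, of "Suc j" j] j by auto
        ultimately show ?thesis using nth[of i p] nth[of "Suc i" p] that j by (simp add: len j_def)
      qed
      moreover have "w p \<noteq> []" using len[of p] by auto
      moreover have "hd (w p) = x p (n p)" using nth[of 0 p] \<open>w p \<noteq> []\<close> by (simp add: hd_conv_nth)
      moreover have "last (w p) = p"
        using nth[of "n p" p] \<open>w p \<noteq> []\<close> by (simp add: last_conv_nth len x0)
      ultimately show ?thesis
        using u[OF p] by (auto simp: half_trek_def directed_walk_def)
    qed
    \<comment> \<open>Systems of half-treks are indexed by their sources, whereas \<open>u\<close>
      and \<open>w\<close> are indexed by the targets.\<close>
    define \<sigma> where "\<sigma> = the_inv_into (pa D v) u"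
    have \<sigma>: "\<sigma> (u p) = p" if "p \<in> pa D v" for p
      using the_inv_into_f_f[OF \<open>inj_on u _\<close> that] by (simp add: \<sigma>_def)
    have "system_no_sided_intersection D B (u ` pa D v) (pa D v)"
      unfolding system_no_sided_intersection_def
    proof (intro exI[of _ \<sigma>] exI[of _ "w \<circ> \<sigma>"] conjI ballI impI)
      show "bij_betw \<sigma> (u ` pa D v) (pa D v)"
        unfolding \<sigma>_def using \<open>inj_on u _\<close> by (simp add: bij_betw_the_inv_into bij_betw_imageI)
    next
      fix y y' assume "y \<in> u ` pa D v" "y' \<in> u ` pa D v" "y \<noteq> y'"
      then show "set ((w \<circ> \<sigma>) y) \<inter> set ((w \<circ> \<sigma>) y') = {}"
        using xinj by (fastforce simp: \<sigma> set)
    qed (auto simp: \<sigma> half_trek)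
    moreover have "card (u ` pa D v) = card (pa D v)"
      using \<open>inj_on u _\<close> by (rule card_image)
    moreover have "u ` pa D v \<inter> ({v} \<union> sib B v) = {}"
      using u by (auto simp: sib_def)
    ultimately have "HTC D B (u ` pa D v) v" by (simp add: HTC_def)
    then show ?thesis using u by blast
  qed
  then obtain Y where Y: "\<And>v. HTC D B (Y v) v" "\<And>v u. u \<in> Y v \<Longrightarrow> \<exists>k. \<tau> (k,v) = Inr {u,v}"
    by metis
  have "w \<notin> Y v" if "v \<noteq> w" "v \<in> Y w" for v w
  proof
    assume "w \<in> Y v"
    then obtain k l where "\<tau> (k,v) = Inr {w,v}" "\<tau> (l,w) = Inr {v,w}" using Y \<open>v \<in> Y w\<close> by blast
    then have "(k,v) = (l,w)" using \<open>inj \<tau>\<close> by (metis injD insert_commute)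
    then show False using \<open>v \<noteq> w\<close> by simp
  qed
  then show ?thesis using Y by blast
qed

subsection \<open>Ordinary differential equations\<close>

text \<open>Banach's fixed point theorem for the integral operator \<open>T\<close>. Clamping times
  to \<open>{0..h}\<close> by \<open>c\<close> allows bounded continuous functions on the whole
  line, a complete metric space as a type; boundedness of \<open>f\<close> keeps \<open>T y\<close>
  in that space.\<close>

lemma Picard_Lindelof:
  fixes f :: "'a::euclidean_space \<Rightarrow> 'a"
  assumes lip: "L-lipschitz_on UNIV f" and "bounded (range f)"
  obtains h :: real and x :: "real \<Rightarrow> 'a" where "h > 0" "x 0 = x0"
    "\<And>t. t \<in> {0..h} \<Longrightarrow> (x has_vector_derivative f (x t)) (at t within {0..h})"
proof -
  have "L \<ge> 0" using lip by (rule lipschitz_on_nonneg)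
  \<comment> \<open>Gives the contraction factor 1/2; the \<open>+ 1\<close> covers
    \<open>L = 0\<close>.\<close>
  define h where "h = 1 / (2 * (L + 1))"
  have h: "h > 0" "L * h \<le> 1/2" using \<open>L \<ge> 0\<close> by (auto simp: h_def field_simps)
  obtain M where M: "\<And>y. norm (f y) \<le> M"
    using \<open>bounded (range f)\<close> by (auto simp: bounded_iff)
  then have "M \<ge> 0" using norm_ge_zero order_trans by blast
  define c where "c t = max 0 (min h t)" for t
  have c: "0 \<le> c t" "c t \<le> h" for t using h by (auto simp: c_def)
  define T where "T y t = x0 + integral {0..c t} (\<lambda>s. f (apply_bcontfun y s))"
    for y :: "real \<Rightarrow>\<^sub>C 'a" and t
  have cont: "continuous_on S (\<lambda>s. f (apply_bcontfun y s))" for y :: "real \<Rightarrow>\<^sub>C 'a" and S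
    by (rule continuous_on_compose2[OF lipschitz_on_continuous_on[OF lip]]) auto
  have T_in: "T y \<in> bcontfun" for y
  proof (rule bcontfun_normI)
    have "continuous_on {0..h} (\<lambda>t. integral {0..t} (\<lambda>s. f (apply_bcontfun y s)))"
      by (intro indefinite_integral_continuous_1 integrable_continuous_real cont)
    moreover have "continuous_on UNIV c" unfolding c_def by (intro continuous_intros)
    ultimately have "continuous_on UNIV (\<lambda>t. integral {0..c t} (\<lambda>s. f (apply_bcontfun y s)))"
      by (rule continuous_on_compose2) (use c in auto)
    then show "continuous_on UNIV (T y)"
      unfolding T_def by (intro continuous_intros)
    show "norm (T y t) \<le> norm x0 + M * h" for t
    proof -
      have "norm (integral {0..c t} (\<lambda>s. f (apply_bcontfun y s))) \<le> M * (c t - 0)"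
        by (rule integral_bound) (use c cont M in auto)
      also have "\<dots> \<le> M * h" using c \<open>M \<ge> 0\<close> by (intro mult_left_mono) auto
      finally show ?thesis unfolding T_def by (intro norm_triangle_le) simp
    qed
  qed
  define F where "F y = Bcontfun (T y)" for y
  have F: "apply_bcontfun (F y) t = T y t" for y t
    by (simp add: F_def Bcontfun_inverse T_in)
  have "dist (F y) (F z) \<le> 1/2 * dist y z" for y z
  proof (rule dist_bound)
    fix t
    have "dist (F y t) (F z t) =
        norm (integral {0..c t} (\<lambda>s. f (apply_bcontfun y s) - f (apply_bcontfun z s)))"
      unfolding F T_def dist_norm
      by (subst integral_diff) (auto intro!: integrable_continuous_real cont)
    also have "\<dots> \<le> L * dist y z * (c t - 0)"
    proof (rule integral_bound)
      show "norm (f (y s) - f (z s)) \<le> L * dist y z" for s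
        using lipschitz_onD[OF lip, of "y s" "z s"] mult_left_mono[OF dist_bounded[of y s z] \<open>L \<ge> 0\<close>]
        by (simp add: dist_norm)
    qed (use c in \<open>auto intro!: continuous_intros cont\<close>)
    also have "\<dots> \<le> L * dist y z * h" using c \<open>L \<ge> 0\<close> by (intro mult_left_mono) auto
    also have "\<dots> \<le> 1/2 * dist y z"
      using mult_right_mono[OF h(2), of "dist y z"] by (simp add: algebra_simps)
    finally show "dist (F y t) (F z t) \<le> 1/2 * dist y z" .
  qed
  then obtain y where "F y = y"
    using banach_fix_type[of "1/2" F] by auto
  then have fix_y: "y t = x0 + integral {0..t} (\<lambda>s. f (y s))" if "t \<in> {0..h}" for t
    using F[of y t] that by (simp add: T_def c_def)
  show thesis
  proof (rule that[of h "apply_bcontfun y"])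
    show "y 0 = x0" using fix_y[of 0] h by simp
    show "(y has_vector_derivative f (y t)) (at t within {0..h})" if "t \<in> {0..h}" for t
    proof (rule has_vector_derivative_transform[OF that fix_y])
      have "((\<lambda>u. integral {0..u} (\<lambda>s. f (y s))) has_vector_derivative f (y t)) (at t within {0..h})"
        by (rule integral_has_vector_derivative[OF cont that])
      then show "((\<lambda>u. x0 + integral {0..u} (\<lambda>s. f (y s))) has_vector_derivative f (y t)) (at t within {0..h})"
        by (auto intro!: derivative_eq_intros)
    qed
  qed (rule h)
qed

text \<open>The inner product with any vector orthogonal to \<open>S\<close> has derivative zero and
  starts at zero; the double orthogonal complement of \<open>S\<close> is \<open>S\<close>.\<close>

lemma curve_in_subspace:
  fixes x :: "real \<Rightarrow> 'a::euclidean_space"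
  assumes "subspace S" "x 0 \<in> S" "h > 0"
    and der: "\<And>t. t \<in> {0..h} \<Longrightarrow> (x has_vector_derivative x' t) (at t within {0..h})"
    and "\<And>t. t \<in> {0..h} \<Longrightarrow> x' t \<in> S"
    and t: "t \<in> {0..h}"
  shows "x t \<in> S"
proof -
  have "orthogonal y (x t)" if y: "y \<in> S\<^sup>\<bottom>" for y
  proof -
    have ortho: "y \<bullet> s = 0" if "s \<in> S" for s
      using y that by (auto simp: orthogonal_comp_def orthogonal_def inner_commute)
    have "((\<lambda>t. y \<bullet> x t) has_vector_derivative 0) (at t within {0..h})" if "t \<in> {0..h}" for t
      using bounded_linear.has_vector_derivative[OF bounded_linear_inner_right der[OF that], of y]
        ortho assms(5)[OF that] by simp
    then obtain c where "\<And>t. t \<in> {0..h} \<Longrightarrow> y \<bullet> x t = c"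
      using has_vector_derivative_zero_constant[of "{0..h}"] by auto
    then have "y \<bullet> x t = y \<bullet> x 0" using t \<open>h > 0\<close> by auto
    then show ?thesis using ortho[OF \<open>x 0 \<in> S\<close>] by (simp add: orthogonal_def)
  qed
  then have "x t \<in> S\<^sup>\<bottom>\<^sup>\<bottom>" by (auto simp: orthogonal_comp_def)
  then show ?thesis using orthogonal_comp_self[OF \<open>subspace S\<close>] by simp
qed

text \<open>At a point where \<open>norm (E t)\<close> is maximal on a short interval, the mean
  value inequality bounds this maximum by half of itself.\<close>

lemma gronwall_zero:
  fixes E :: "real \<Rightarrow> 'a::real_inner"
  assumes "h > 0" "E 0 = 0"
    and der: "\<And>t. t \<in> {0..h} \<Longrightarrow> (E has_vector_derivative E' t) (at t within {0..h})"
    and bound: "\<And>t. t \<in> {0..h} \<Longrightarrow> norm (E' t) \<le> C * norm (E t)"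
  obtains d where "0 < d" "d \<le> h" "\<And>t. t \<in> {0..d} \<Longrightarrow> E t = 0"
proof -
  define d where "d = min h (1 / (2 * (\<bar>C\<bar> + 1)))"
  have d: "0 < d" "d \<le> h" "\<bar>C\<bar> * d \<le> 1/2"
  proof -
    show "0 < d" "d \<le> h" using \<open>h > 0\<close> by (auto simp: d_def)
    have "\<bar>C\<bar> * d \<le> \<bar>C\<bar> * (1 / (2 * (\<bar>C\<bar> + 1)))" by (intro mult_left_mono) (auto simp: d_def)
    also have "\<dots> \<le> 1/2" by (simp add: field_simps)
    finally show "\<bar>C\<bar> * d \<le> 1/2" .
  qed
  have cont: "continuous_on {0..d} E"
  proof (rule continuous_on_subset)
    show "continuous_on {0..h} E"
      unfolding continuous_on_eq_continuous_within
      using has_vector_derivative_continuous[OF der] by simp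
  qed (use d in auto)
  then have "continuous_on {0..d} (\<lambda>t. norm (E t))" by (intro continuous_intros)
  then obtain s where s: "s \<in> {0..d}" "\<And>t. t \<in> {0..d} \<Longrightarrow> norm (E t) \<le> norm (E s)"
    using continuous_attains_sup[of "{0..d}" "\<lambda>t. norm (E t)"] d(1) by auto
  have "E s = 0"
  proof (cases "s = 0")
    case False
    then have "0 < s" "s \<le> d" using s by auto
    have "\<exists>t\<in>{0<..<s}. norm (E s - E 0) \<le> norm ((s - 0) *\<^sub>R E' t)"
    proof (rule mvt_general[OF \<open>0 < s\<close>, where f' = "\<lambda>t u. u *\<^sub>R E' t"])
      show "continuous_on {0..s} E" using cont by (rule continuous_on_subset) (use s in auto)
      fix t assume t: "0 < t" "t < s"
      \<comment> \<open>At an interior time the derivative within \<open>{0..h}\<close> is an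
        ordinary one, as the mean value inequality demands.\<close>
      then have "(E has_vector_derivative E' t) (at t within {0<..<h})"
        using \<open>s \<le> d\<close> d by (intro has_vector_derivative_within_subset[OF der]) auto
      then show "(E has_derivative (\<lambda>u. u *\<^sub>R E' t)) (at t)"
        using at_within_open[of t "{0<..<h}"] t \<open>s \<le> d\<close> d
        by (simp add: has_vector_derivative_def)
    qed
    then obtain t where t: "0 < t" "t < s" "norm (E s) \<le> s * norm (E' t)"
      using \<open>E 0 = 0\<close> \<open>0 < s\<close> by auto
    have E's: "norm (E' t) \<le> \<bar>C\<bar> * norm (E s)"
    proof -
      have "norm (E' t) \<le> C * norm (E t)" using bound t \<open>s \<le> d\<close> d by auto
      also have "\<dots> \<le> \<bar>C\<bar> * norm (E t)" by (intro mult_right_mono) auto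
      also have "\<dots> \<le> \<bar>C\<bar> * norm (E s)" using s t by (intro mult_left_mono) auto
      finally show ?thesis .
    qed
    then have "norm (E s) \<le> d * (\<bar>C\<bar> * norm (E s))"
      using t(3) mult_mono[OF \<open>s \<le> d\<close> E's] \<open>0 < s\<close> \<open>s \<le> d\<close> by simp
    also have "\<dots> \<le> 1/2 * norm (E s)"
      using mult_right_mono[OF d(3) norm_ge_zero[of "E s"]] by (simp add: mult_ac)
    finally show ?thesis by simp
  qed (use \<open>E 0 = 0\<close> in simp)
  then have "E t = 0" if "t \<in> {0..d}" for t using s(2)[OF that] by simp
  then show thesis using that d by blast
qed

subsection \<open>The parameter space and its polynomial functions\<close>

lemma bounded_bilinear_matrix_vector_mult:
  "bounded_bilinear ((*v) :: real^'n::finite^'m::finite \<Rightarrow> real^'n \<Rightarrow> real^'m)"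
  unfolding bilinear_conv_bounded_bilinear[symmetric] bilinear_def
  by (auto intro!: linearI simp: matrix_vector_mult_add_rdistrib vec_eq_iff
      matrix_vector_mult_def sum_distrib_left sum.distrib algebra_simps)

lemma bounded_bilinear_matrix_matrix_mult:
  "bounded_bilinear ((**) :: real^'n::finite^'m::finite \<Rightarrow> real^'p::finite^'n \<Rightarrow> real^'p^'m)"
  unfolding bilinear_conv_bounded_bilinear[symmetric] bilinear_def
  by (auto intro!: linearI simp: matrix_add_ldistrib scalar_matrix_assoc matrix_scalar_ac
      matrix_matrix_mult_def vec_eq_iff sum.distrib algebra_simps sum_distrib_left)

lemma bounded_linear_transpose:
  "bounded_linear (transpose :: real^'n::finite^'m::finite \<Rightarrow> real^'m^'n)"
  unfolding linear_conv_bounded_linear[symmetric]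
  by (auto intro!: linearI simp: transpose_def vec_eq_iff)

lemma matrix_inv:
  fixes A :: "real^'n::finite^'n"
  assumes "invertible A"
  shows "A ** matrix_inv A = mat 1" "matrix_inv A ** A = mat 1"
  using someI_ex[OF assms[unfolded invertible_def]] by (simp_all add: matrix_inv_def)

text \<open>The quadratic form of \<open>A\<close> has a positive minimum \<open>m\<close> on the
  compact unit sphere. A small perturbation changes it there by less than \<open>m\<close>, and
  scaling covers the other vectors.\<close>

lemma pos_def_mat_nearby:
  fixes A :: "real^'v::finite^'v"
  assumes "pos_def_mat A"
  obtains e where "e > 0" "\<And>C. transpose C = C \<Longrightarrow> dist A C \<le> e \<Longrightarrow> pos_def_mat C"
proof -
  let ?S = "sphere 0 1 :: (real^'v) set"
  have "?S \<noteq> {}" by simp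
  moreover have "continuous_on ?S (\<lambda>u. u \<bullet> (A *v u))"
    by (intro continuous_intros)
  ultimately obtain u0 where u0: "u0 \<in> ?S" "\<And>u. u \<in> ?S \<Longrightarrow> u0 \<bullet> (A *v u0) \<le> u \<bullet> (A *v u)"
    using continuous_attains_inf[of ?S] compact_sphere by blast
  define m where "m = u0 \<bullet> (A *v u0)"
  have "u0 \<noteq> 0" using u0(1) by auto
  then have "m > 0" using assms by (simp add: pos_def_mat_def m_def)
  obtain k where "k > 0" and k: "\<And>(M :: real^'v^'v) u. norm (M *v u) \<le> norm M * norm u * k"
    using bounded_bilinear.pos_bounded[OF bounded_bilinear_matrix_vector_mult] by blast
  \<comment> \<open>The change on unit vectors is then at most \<open>e * k = m / 2\<close>.\<close>
  define e where "e = m / (2 * k)"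
  have "e > 0" using \<open>m > 0\<close> \<open>k > 0\<close> by (simp add: e_def)
  moreover have "pos_def_mat C" if C: "transpose C = C" "dist A C \<le> e" for C
    unfolding pos_def_mat_def
  proof (intro conjI allI impI C)
    fix x :: "real^'v" assume "x \<noteq> 0"
    define u where "u = x /\<^sub>R norm x"
    have u: "u \<in> ?S" "norm u = 1" using \<open>x \<noteq> 0\<close> by (auto simp: u_def)
    have "\<bar>u \<bullet> ((A - C) *v u)\<bar> \<le> norm u * norm ((A - C) *v u)"
      by (rule Cauchy_Schwarz_ineq2)
    also have "\<dots> \<le> dist A C * k" using k[of "A - C" u] u by (simp add: dist_norm)
    also have "\<dots> \<le> e * k" using C \<open>k > 0\<close> by (intro mult_right_mono) auto
    also have "\<dots> < m" using \<open>m > 0\<close> \<open>k > 0\<close> by (simp add: e_def)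
    finally have "u \<bullet> (A *v u) - u \<bullet> (C *v u) < m"
      by (simp add: matrix_vector_mult_diff_rdistrib inner_diff_right)
    then have "u \<bullet> (C *v u) > 0" using u0(2)[OF u(1)] by (simp add: m_def)
    moreover have "x = norm x *\<^sub>R u" using \<open>x \<noteq> 0\<close> by (simp add: u_def)
    then have "x \<bullet> (C *v x) = (norm x)\<^sup>2 * (u \<bullet> (C *v u))"
      by (metis (no_types, lifting) inner_scaleR_left inner_scaleR_right matrix_vector_mult_scaleR
          mult.assoc power2_eq_square)
    ultimately show "x \<bullet> (C *v x) > 0" using \<open>x \<noteq> 0\<close> by simp
  qed
  ultimately show thesis using that by blast
qed

section \<open>The parameter space inside its linear space of zero patterns\<close>

definition pattern_space ::
    "('v::finite \<times> 'v) set \<Rightarrow> ('v \<times> 'v) set \<Rightarrow> ((real^'v^'v) \<times> (real^'v^'v)) set" where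
  "pattern_space D B = {(\<Lambda>, \<Omega>). (\<forall>v w. (v,w) \<notin> D \<longrightarrow> \<Lambda> $ v $ w = 0) \<and>
     transpose \<Omega> = \<Omega> \<and> (\<forall>v w. v \<noteq> w \<and> (v,w) \<notin> B \<longrightarrow> \<Omega> $ v $ w = 0)}"

lemma subspace_pattern_space: "subspace (pattern_space D B)"
  by (rule subspaceI) (auto simp: pattern_space_def transpose_def vec_eq_iff zero_prod_def)

lemma Theta_iff:
  "\<theta> \<in> Theta D B \<longleftrightarrow>
     \<theta> \<in> pattern_space D B \<and> invertible (mat 1 - fst \<theta>) \<and> pos_def_mat (snd \<theta>)"
  by (auto simp: Theta_def pattern_space_def pos_def_mat_def)

lemma Theta_nonempty: "Theta D B \<noteq> {}"
proof -
  have "invertible (mat 1 :: real^'v::finite^'v)"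
    unfolding invertible_def by (rule exI[of _ "mat 1"]) simp
  moreover have "pos_def_mat (mat 1 :: real^'v^'v)"
    by (auto simp: pos_def_mat_def)
  moreover have "(0, mat 1) \<in> pattern_space D B"
    by (simp add: pattern_space_def) (simp add: mat_def)
  ultimately have "(0, mat 1) \<in> Theta D B"
    by (simp add: Theta_iff)
  then show ?thesis by blast
qed

text \<open>Invertibility is open by the determinant, and positive definiteness is open among
  symmetric matrices. The ball is closed so that it later yields a compact set.\<close>

lemma Theta_nearby:
  assumes "\<theta> \<in> Theta D B"
  obtains r where "r > 0" "cball \<theta> r \<inter> pattern_space D B \<subseteq> Theta D B"
proof -
  let ?U = "{\<theta> :: (real^'a^'a) \<times> (real^'a^'a). det (mat 1 - fst \<theta>) \<noteq> 0}"
  have "open ?U"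
    unfolding det_def by (intro open_Collect_neq continuous_intros)
  moreover have "\<theta> \<in> ?U" using assms by (auto simp: Theta_iff invertible_det_nz)
  ultimately obtain r1 where r1: "r1 > 0" "cball \<theta> r1 \<subseteq> ?U"
    using open_contains_cball by blast
  have "pos_def_mat (snd \<theta>)" using assms by (simp add: Theta_iff)
  then obtain r2 where r2: "r2 > 0" "\<And>C. transpose C = C \<Longrightarrow> dist (snd \<theta>) C \<le> r2 \<Longrightarrow> pos_def_mat C"
    using pos_def_mat_nearby by blast
  have "\<theta>' \<in> Theta D B" if "\<theta>' \<in> cball \<theta> (min r1 r2) \<inter> pattern_space D B" for \<theta>'
  proof -
    have "dist (snd \<theta>) (snd \<theta>') \<le> r2" using that dist_snd_le[of \<theta> \<theta>'] by auto
    moreover have "transpose (snd \<theta>') = snd \<theta>'" using that by (auto simp: pattern_space_def)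
    moreover have "\<theta>' \<in> ?U" using that r1 by auto
    ultimately show ?thesis using that r2 by (auto simp: Theta_iff invertible_det_nz)
  qed
  then have "cball \<theta> (min r1 r2) \<inter> pattern_space D B \<subseteq> Theta D B" by (rule subsetI)
  then show thesis by (rule that[rotated]) (use r1 r2 in simp)
qed

section \<open>Polynomial functions on the parameter space\<close>

lemma poly_fun_fst: "(\<lambda>x. fst x $ i $ j) \<in> poly_fun"
  using poly_fun.lam[of i j] by (simp add: case_prod_unfold)

lemma poly_fun_snd: "(\<lambda>x. snd x $ i $ j) \<in> poly_fun"
  using poly_fun.om[of i j] by (simp add: case_prod_unfold)

lemma poly_fun_uminus: "f \<in> poly_fun \<Longrightarrow> (\<lambda>x. - f x) \<in> poly_fun"
  using poly_fun.mult[OF poly_fun.const[of "-1"]] by fastforce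

lemma poly_fun_diff: "f \<in> poly_fun \<Longrightarrow> g \<in> poly_fun \<Longrightarrow> (\<lambda>x. f x - g x) \<in> poly_fun"
  using poly_fun.add[OF _ poly_fun_uminus] by fastforce

lemma poly_fun_sum: "(\<And>k. f k \<in> poly_fun) \<Longrightarrow> (\<lambda>x. \<Sum>k\<in>K. f k x) \<in> poly_fun"
proof (induction K rule: infinite_finite_induct)
  case (insert k K)
  then show ?case using poly_fun.add[of "f k"] by simp
qed (use poly_fun.const in auto)

lemmas poly_fun_intros =
  poly_fun.const poly_fun.add poly_fun.mult poly_fun_fst poly_fun_snd
  poly_fun_uminus poly_fun_diff poly_fun_sum

lemma poly_fun_on_line:
  assumes "p \<in> poly_fun"
  shows "\<exists>q. \<forall>t. p (x + t *\<^sub>R y) = poly q t"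
  using assms
proof (induction rule: poly_fun.induct)
  case (const c)
  show ?case by (rule exI[of _ "[:c:]"]) simp
next
  case (lam i j)
  show ?case by (rule exI[of _ "[:fst x $ i $ j, fst y $ i $ j:]"]) (simp add: case_prod_unfold)
next
  case (om i j)
  show ?case by (rule exI[of _ "[:snd x $ i $ j, snd y $ i $ j:]"]) (simp add: case_prod_unfold)
next
  case (add f g)
  then obtain a b where "\<forall>t. f (x + t *\<^sub>R y) = poly a t" "\<forall>t. g (x + t *\<^sub>R y) = poly b t" by blast
  then show ?case by (intro exI[of _ "a + b"]) simp
next
  case (mult f g)
  then obtain a b where "\<forall>t. f (x + t *\<^sub>R y) = poly a t" "\<forall>t. g (x + t *\<^sub>R y) = poly b t" by blast
  then show ?case by (intro exI[of _ "a * b"]) simp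
qed

text \<open>On the line through two points of \<open>Theta D B\<close>, both polynomials have finitely many zeros,
  while the line stays in \<open>Theta D B\<close> for small parameters.\<close>
lemma poly_fun_mult_nonzero:
  assumes "p \<in> poly_fun" "q \<in> poly_fun"
    and "\<exists>\<theta>\<in>Theta D B. p \<theta> \<noteq> 0" "\<exists>\<theta>\<in>Theta D B. q \<theta> \<noteq> 0"
  shows "\<exists>\<theta>\<in>Theta D B. p \<theta> * q \<theta> \<noteq> 0"
proof -
  obtain x z where x: "x \<in> Theta D B" "p x \<noteq> 0" and z: "z \<in> Theta D B" "q z \<noteq> 0"
    using assms by blast
  define y where "y = z - x"
  obtain a b where a: "\<And>t. p (x + t *\<^sub>R y) = poly a t" and b: "\<And>t. q (x + t *\<^sub>R y) = poly b t"
    using poly_fun_on_line assms(1,2) by metis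
  \<comment> \<open>The line meets \<open>x\<close> at parameter 0 and \<open>z\<close> at 1. The
    segment between them may leave \<open>Theta D B\<close>, but both restrictions are nonzero
    polynomials, and this can be exploited near 0.\<close>
  have "poly a 0 \<noteq> 0" "poly b 1 \<noteq> 0" using a[of 0] b[of 1] x z by (auto simp: y_def)
  then have "a * b \<noteq> 0" by auto
  then have fin: "finite {t. poly (a * b) t = 0}" by (rule poly_roots_finite)
  obtain r where r: "r > 0" "cball x r \<inter> pattern_space D B \<subseteq> Theta D B"
    using Theta_nearby[OF x(1)] by blast
  \<comment> \<open>For \<open>0 < t < e\<close> the displacement \<open>t *\<^sub>R y\<close> has
    norm at most \<open>r\<close>; the \<open>+ 1\<close> avoids division by zero.\<close>
  define e where "e = r / (norm y + 1)"
  have "norm y + 1 > 0" by (simp add: add_nonneg_pos)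
  then have "e > 0" and e: "e * (norm y + 1) = r" using r by (auto simp: e_def)
  have "infinite ({0<..<e} - {t. poly (a * b) t = 0})"
    using fin \<open>e > 0\<close> by (intro Diff_infinite_finite) (auto simp: infinite_Ioo)
  then have "{0<..<e} - {t. poly (a * b) t = 0} \<noteq> {}" by (rule infinite_imp_nonempty)
  then obtain t where "t \<in> {0<..<e} - {t. poly (a * b) t = 0}" by blast
  then have t: "0 < t" "t < e" "poly (a * b) t \<noteq> 0" by auto
  have "x + t *\<^sub>R y \<in> pattern_space D B"
    using x z subspace_pattern_space[of D B] unfolding y_def Theta_iff
    by (intro subspace_add subspace_scale subspace_diff) auto
  moreover have "norm (t *\<^sub>R y) \<le> e * (norm y + 1)"
    unfolding norm_scaleR using t \<open>e > 0\<close> by (intro mult_mono) auto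
  then have "dist x (x + t *\<^sub>R y) \<le> r"
    unfolding e dist_norm by (subst norm_minus_commute) (simp only: add_diff_cancel_left')
  then have "x + t *\<^sub>R y \<in> cball x r" by simp
  ultimately have "x + t *\<^sub>R y \<in> Theta D B" using r by blast
  moreover have "p (x + t *\<^sub>R y) * q (x + t *\<^sub>R y) \<noteq> 0" using t a b by simp
  ultimately show ?thesis by blast
qed

text \<open>The induction carries a bound along with the Lipschitz constant, because the product
  step needs both factors bounded.\<close>

lemma poly_fun_lipschitz:
  assumes "p \<in> poly_fun" "bounded K"
  shows "\<exists>L. L-lipschitz_on K p"
proof -
  obtain b where b: "\<And>x. x \<in> K \<Longrightarrow> norm x \<le> b" using \<open>bounded K\<close> by (auto simp: bounded_iff)
  have entry: "\<bar>A $ i $ j\<bar> \<le> norm A" for A :: "real^'a^'a" and i j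
    using order_trans[OF component_le_norm_cart Finite_Cartesian_Product.norm_nth_le] .
  have "\<exists>L C. L-lipschitz_on K p \<and> (\<forall>x\<in>K. \<bar>p x\<bar> \<le> C)"
    using assms(1)
  proof (induction rule: poly_fun.induct)
    case (const c)
    show ?case by (intro exI[of _ 0] exI[of _ "\<bar>c\<bar>"]) (auto intro: lipschitz_on_constant)
  next
    case (lam i j)
    have *: "\<bar>fst x $ i $ j\<bar> \<le> norm x" for x :: "(real^'a^'a) \<times> (real^'a^'a)"
      using order_trans[OF entry norm_fst_le[of "fst x" "snd x"]] by simp
    have "dist (fst x $ i $ j) (fst y $ i $ j) \<le> 1 * dist x y"
      for x y :: "(real^'a^'a) \<times> (real^'a^'a)"
      using *[of "x - y"] by (simp add: dist_norm)
    then have "1-lipschitz_on K (\<lambda>x. fst x $ i $ j)" by (intro lipschitz_onI) auto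
    moreover have "\<forall>x\<in>K. \<bar>fst x $ i $ j\<bar> \<le> b" using * b order_trans by blast
    ultimately show ?case unfolding case_prod_unfold by blast
  next
    case (om i j)
    have *: "\<bar>snd x $ i $ j\<bar> \<le> norm x" for x :: "(real^'a^'a) \<times> (real^'a^'a)"
      using order_trans[OF entry norm_snd_le[of "snd x" "fst x"]] by simp
    have "dist (snd x $ i $ j) (snd y $ i $ j) \<le> 1 * dist x y"
      for x y :: "(real^'a^'a) \<times> (real^'a^'a)"
      using *[of "x - y"] by (simp add: dist_norm)
    then have "1-lipschitz_on K (\<lambda>x. snd x $ i $ j)" by (intro lipschitz_onI) auto
    moreover have "\<forall>x\<in>K. \<bar>snd x $ i $ j\<bar> \<le> b" using * b order_trans by blast
    ultimately show ?case unfolding case_prod_unfold by blast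
  next
    case (add f g)
    then obtain L1 C1 L2 C2 where 1: "L1-lipschitz_on K f" "\<forall>x\<in>K. \<bar>f x\<bar> \<le> C1"
      and 2: "L2-lipschitz_on K g" "\<forall>x\<in>K. \<bar>g x\<bar> \<le> C2" by blast
    have "\<bar>f x + g x\<bar> \<le> C1 + C2" if "x \<in> K" for x
      using 1(2) 2(2) that abs_triangle_ineq[of "f x" "g x"] by fastforce
    then show ?case using lipschitz_on_add[OF 1(1) 2(1)] by blast
  next
    case (mult f g)
    then obtain L1 C1 L2 C2 where 1: "L1-lipschitz_on K f" "\<forall>x\<in>K. \<bar>f x\<bar> \<le> C1"
      and 2: "L2-lipschitz_on K g" "\<forall>x\<in>K. \<bar>g x\<bar> \<le> C2" by blast
    note nonneg = lipschitz_on_nonneg[OF 1(1)] lipschitz_on_nonneg[OF 2(1)]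
    have "dist (f x * g x) (f y * g y) \<le> (\<bar>C1\<bar> * L2 + \<bar>C2\<bar> * L1) * dist x y"
      if "x \<in> K" "y \<in> K" for x y
    proof -
      have "f x * g x - f y * g y = f x * (g x - g y) + g y * (f x - f y)" by algebra
      then have "dist (f x * g x) (f y * g y) \<le> \<bar>f x\<bar> * dist (g x) (g y) + \<bar>g y\<bar> * dist (f x) (f y)"
        using abs_triangle_ineq[of "f x * (g x - g y)" "g y * (f x - f y)"]
        by (simp add: dist_real_def abs_mult)
      also have "\<dots> \<le> \<bar>C1\<bar> * (L2 * dist x y) + \<bar>C2\<bar> * (L1 * dist x y)"
        using 1(2) 2(2) that lipschitz_onD[OF 1(1) that] lipschitz_onD[OF 2(1) that]
        by (intro add_mono mult_mono) (auto intro: order_trans[OF _ abs_ge_self])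
      finally show ?thesis by (simp add: algebra_simps)
    qed
    then have "(\<bar>C1\<bar> * L2 + \<bar>C2\<bar> * L1)-lipschitz_on K (\<lambda>x. f x * g x)"
      by (rule lipschitz_onI) (use nonneg in auto)
    moreover have "\<forall>x\<in>K. \<bar>f x * g x\<bar> \<le> \<bar>C1\<bar> * \<bar>C2\<bar>"
    proof
      fix x assume "x \<in> K"
      then have "\<bar>f x\<bar> \<le> \<bar>C1\<bar>" "\<bar>g x\<bar> \<le> \<bar>C2\<bar>" using 1(2) 2(2) by force+
      then show "\<bar>f x * g x\<bar> \<le> \<bar>C1\<bar> * \<bar>C2\<bar>" unfolding abs_mult by (intro mult_mono) auto
    qed
    ultimately show ?case by blast
  qed
  then show ?thesis by blast
qed

lemma lipschitz_on_componentwise_cart: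
  fixes F :: "'e::metric_space \<Rightarrow> 'b::real_normed_vector^'n::finite"
  assumes "\<And>i. \<exists>L. L-lipschitz_on K (\<lambda>x. F x $ i)"
  shows "\<exists>L. L-lipschitz_on K F"
proof -
  obtain L where L: "\<And>i. (L i)-lipschitz_on K (\<lambda>x. F x $ i)" using assms by metis
  have "dist (F x) (F y) \<le> (\<Sum>i\<in>UNIV. L i) * dist x y" if "x \<in> K" "y \<in> K" for x y
  proof -
    have "dist (F x) (F y) \<le> (\<Sum>i\<in>UNIV. dist (F x $ i) (F y $ i))"
      unfolding dist_vec_def by (rule L2_set_le_sum) simp
    also have "\<dots> \<le> (\<Sum>i\<in>UNIV. L i * dist x y)"
      using L that by (intro sum_mono) (auto dest: lipschitz_onD)
    finally show ?thesis by (simp add: sum_distrib_right)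
  qed
  then show ?thesis
    using lipschitz_onI[of K F "\<Sum>i\<in>UNIV. L i"] sum_nonneg[of UNIV L] lipschitz_on_nonneg[OF L]
    by blast
qed

subsection \<open>Integral curves in the fibres\<close>

text \<open>Along an integral curve of \<open>V\<close> the matrix \<open>A = I - \<Lambda>\<close>
  has derivative \<open>A G\<close>, so the defect \<open>E = A^T \<Sigma> A - \<Omega>\<close>
  solves the linear equation \<open>E' = G^T E + E G\<close> with \<open>E 0 = 0\<close>. Hence
  \<open>E\<close> vanishes for a short time and the curve stays in the fibre; it is not constant
  because \<open>V \<theta>0\<close> is nonzero.\<close>

lemma infinite_fiber:
  fixes G :: "(real^'v::finite^'v) \<times> (real^'v^'v) \<Rightarrow> real^'v^'v"
  assumes G_poly: "\<And>k v. (\<lambda>\<theta>. G \<theta> $ k $ v) \<in> poly_fun"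
    and ker1: "\<And>\<theta> k v. \<lbrakk>\<theta> \<in> Theta D B; (k,v) \<notin> D\<rbrakk> \<Longrightarrow> ((mat 1 - fst \<theta>) ** G \<theta>) $ k $ v = 0"
    and ker2: "\<And>\<theta> u v. \<lbrakk>\<theta> \<in> Theta D B; u \<noteq> v; (u,v) \<notin> B\<rbrakk>
      \<Longrightarrow> (snd \<theta> ** G \<theta> + transpose (G \<theta>) ** snd \<theta>) $ u $ v = 0"
    and \<theta>0: "\<theta>0 \<in> Theta D B" "G \<theta>0 \<noteq> 0"
  shows "infinite {\<theta>' \<in> Theta D B. phi \<theta>' = phi \<theta>0}"
proof -
  define V where "V \<theta> = (- ((mat 1 - fst \<theta>) ** G \<theta>), snd \<theta> ** G \<theta> + transpose (G \<theta>) ** snd \<theta>)" for \<theta>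
  let ?S = "pattern_space D B"
  have V_in: "V \<theta> \<in> ?S" if "\<theta> \<in> Theta D B" for \<theta>
  proof -
    have sym: "transpose (snd \<theta>) = snd \<theta>" using that by (auto simp: Theta_iff pos_def_mat_def)
    have "transpose (snd \<theta> ** G \<theta> + transpose (G \<theta>) ** snd \<theta>) = snd \<theta> ** G \<theta> + transpose (G \<theta>) ** snd \<theta>"
      by (simp only: linear_add[OF bounded_linear.linear[OF bounded_linear_transpose]]
          matrix_transpose_mul transpose_transpose sym add.commute)
    then show ?thesis using ker1[OF that] ker2[OF that] by (auto simp: V_def pattern_space_def)
  qed
  obtain r where r: "r > 0" "cball \<theta>0 r \<inter> ?S \<subseteq> Theta D B"
    using Theta_nearby[OF \<theta>0(1)] by blast
  \<comment> \<open>The polynomial field is Lipschitz on a bounded set; convexity and closedness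
    give a nonexpansive closest-point projection.\<close>
  define K where "K = cball \<theta>0 r \<inter> ?S"
  have K: "K \<subseteq> Theta D B" "convex K" "compact K" "closed K" "K \<noteq> {}" "\<theta>0 \<in> K"
  proof -
    show "K \<subseteq> Theta D B" using r by (simp add: K_def)
    show "convex K" unfolding K_def
      by (intro convex_Int subspace_imp_convex subspace_pattern_space convex_cball)
    show "compact K" unfolding K_def
      by (intro compact_Int_closed closed_subspace subspace_pattern_space compact_cball)
    then show "closed K" by (rule compact_imp_closed)
    show "\<theta>0 \<in> K" using \<theta>0 r by (auto simp: K_def Theta_iff)
    then show "K \<noteq> {}" by blast
  qed
  have "bounded K" using K by (simp add: compact_imp_bounded)
  have "\<exists>L. L-lipschitz_on K (\<lambda>\<theta>. fst (V \<theta>))" "\<exists>L. L-lipschitz_on K (\<lambda>\<theta>. snd (V \<theta>))"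
    by (intro lipschitz_on_componentwise_cart poly_fun_lipschitz[OF _ \<open>bounded K\<close>];
        simp add: V_def matrix_matrix_mult_def transpose_def mat_def; intro poly_fun_intros G_poly)+
  moreover have "\<exists>L. L-lipschitz_on K G"
    by (intro lipschitz_on_componentwise_cart poly_fun_lipschitz[OF _ \<open>bounded K\<close>] G_poly)
  ultimately obtain L1 L2 L3 where L: "L1-lipschitz_on K (\<lambda>\<theta>. fst (V \<theta>))" "L2-lipschitz_on K (\<lambda>\<theta>. snd (V \<theta>))"
      and G_lip: "L3-lipschitz_on K G" by blast
  obtain L where V_lip: "L-lipschitz_on K V"
    using lipschitz_on_Pair[OF L] by auto
  \<comment> \<open>Precomposing with the projection extends \<open>V\<close> from \<open>K\<close>
    to a globally Lipschitz bounded field, as \<open>Picard_Lindelof\<close> requires.\<close>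
  define f where "f = V \<circ> closest_point K"
  have cp_in: "closest_point K \<theta> \<in> K" for \<theta> using K by (intro closest_point_in_set)
  have "L-lipschitz_on UNIV f"
  proof (rule lipschitz_onI)
    fix x y
    have "dist (f x) (f y) \<le> L * dist (closest_point K x) (closest_point K y)"
      using lipschitz_onD[OF V_lip cp_in cp_in] by (simp add: f_def)
    also have "\<dots> \<le> L * dist x y"
      using K lipschitz_on_nonneg[OF V_lip] by (intro mult_left_mono closest_point_lipschitz)
    finally show "dist (f x) (f y) \<le> L * dist x y" .
  qed (rule lipschitz_on_nonneg[OF V_lip])
  moreover have "bounded (range f)"
  proof (rule bounded_subset)
    show "bounded (V ` K)"
      by (intro compact_imp_bounded compact_continuous_image K lipschitz_on_continuous_on[OF V_lip])
    show "range f \<subseteq> V ` K" using cp_in by (auto simp: f_def)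
  qed
  ultimately obtain h x where h: "h > 0" and x0: "x 0 = \<theta>0"
    and der: "\<And>t. t \<in> {0..h} \<Longrightarrow> (x has_vector_derivative f (x t)) (at t within {0..h})"
    using Picard_Lindelof by blast
  \<comment> \<open>The values of \<open>f\<close> lie in the linear pattern space, so the curve
    stays there and can leave \<open>K\<close> only by leaving the ball.\<close>
  have f_in: "f \<theta> \<in> ?S" for \<theta>
    using V_in[OF subsetD[OF K(1) cp_in]] by (simp add: f_def)
  have "x 0 \<in> ?S" using x0 K(6) by (simp add: K_def)
  then have x_pattern: "x t \<in> ?S" if "t \<in> {0..h}" for t
    using curve_in_subspace[OF subspace_pattern_space _ h der f_in that] by blast
  have x_cont: "continuous_on {0..h} x"
    unfolding continuous_on_eq_continuous_within
    using has_vector_derivative_continuous[OF der] by simp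
  then obtain d where d: "d > 0" "\<And>t. \<lbrakk>t \<in> {0..h}; dist t 0 < d\<rbrakk> \<Longrightarrow> dist (x t) (x 0) < r"
    using r(1) h unfolding continuous_on_iff by (metis atLeastAtMost_iff less_eq_real_def)
  \<comment> \<open>Up to time \<open>h1\<close> the curve is still in \<open>K\<close>, where
    \<open>f\<close> agrees with \<open>V\<close>.\<close>
  define h1 where "h1 = min h (d/2)"
  have h1: "0 < h1" "h1 \<le> h" "h1 < d" using d h by (auto simp: h1_def)
  have x_K: "x t \<in> K" if "t \<in> {0..h1}" for t
    using d(2)[of t] x_pattern[of t] that h1 x0 by (auto simp: K_def dist_commute)
  have der1: "(x has_vector_derivative V (x t)) (at t within {0..h1})" if "t \<in> {0..h1}" for t
  proof -
    have "f (x t) = V (x t)" using closest_point_self[OF x_K[OF that]] by (simp add: f_def)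
    then show ?thesis
      using has_vector_derivative_within_subset[OF der, of t "{0..h1}"] that h1 by auto
  qed
  define \<Sigma> where "\<Sigma> = phi \<theta>0"
  define A where "A t = mat 1 - fst (x t)" for t
  \<comment> \<open>Clearing the inverses turns \<open>phi \<theta> = \<Sigma>\<close> into
    \<open>E = 0\<close>, so no inverse has to be differentiated.\<close>
  define E where "E t = transpose (A t) ** \<Sigma> ** A t - snd (x t)" for t
  have \<Sigma>: "\<Sigma> = phi \<theta> \<longleftrightarrow> transpose (mat 1 - fst \<theta>) ** \<Sigma> ** (mat 1 - fst \<theta>) = snd \<theta>"
    if "\<theta> \<in> Theta D B" for \<theta>
  proof -
    let ?A = "mat 1 - fst \<theta>"
    have inv: "?A ** matrix_inv ?A = mat 1" "matrix_inv ?A ** ?A = mat 1"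
      using that by (auto simp: Theta_iff intro: matrix_inv)
    then have inv': "transpose ?A ** transpose (matrix_inv ?A) = mat 1"
      "transpose (matrix_inv ?A) ** transpose ?A = mat 1"
      by (metis matrix_transpose_mul transpose_mat)+
    have phi: "phi \<theta> = transpose (matrix_inv ?A) ** snd \<theta> ** matrix_inv ?A"
      by (simp add: phi_def case_prod_unfold)
    show ?thesis
    proof
      assume "\<Sigma> = phi \<theta>"
      then have "transpose ?A ** \<Sigma> ** ?A =
          (transpose ?A ** transpose (matrix_inv ?A)) ** snd \<theta> ** (matrix_inv ?A ** ?A)"
        by (simp only: phi matrix_mul_assoc)
      then show "transpose ?A ** \<Sigma> ** ?A = snd \<theta>" using inv inv' by simp
    next
      assume "transpose ?A ** \<Sigma> ** ?A = snd \<theta>"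
      then have "phi \<theta> = (transpose (matrix_inv ?A) ** transpose ?A) ** \<Sigma> ** (?A ** matrix_inv ?A)"
        by (metis phi matrix_mul_assoc)
      then show "\<Sigma> = phi \<theta>" using inv inv' by simp
    qed
  qed
  define E' where "E' t = transpose (G (x t)) ** E t + E t ** G (x t)" for t
  note bb = bounded_bilinear_matrix_matrix_mult
  have E_der: "(E has_vector_derivative E' t) (at t within {0..h1})" if "t \<in> {0..h1}" for t
  proof -
    have "((\<lambda>t. fst (x t)) has_vector_derivative fst (V (x t))) (at t within {0..h1})"
      by (rule bounded_linear.has_vector_derivative[OF bounded_linear_fst der1[OF that]])
    then have A: "(A has_vector_derivative A t ** G (x t)) (at t within {0..h1})"
      unfolding A_def by (auto intro!: derivative_eq_intros simp: V_def)
    have At: "((\<lambda>t. transpose (A t)) has_vector_derivative transpose (A t ** G (x t))) (at t within {0..h1})"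
      by (rule bounded_linear.has_vector_derivative[OF bounded_linear_transpose A])
    have "((\<lambda>t. transpose (A t) ** \<Sigma>) has_vector_derivative transpose (A t ** G (x t)) ** \<Sigma>) (at t within {0..h1})"
      by (rule bounded_linear.has_vector_derivative[OF bounded_bilinear.bounded_linear_left[OF bb] At])
    note bounded_bilinear.has_vector_derivative[OF bb this A]
    moreover have "((\<lambda>t. snd (x t)) has_vector_derivative snd (V (x t))) (at t within {0..h1})"
      by (rule bounded_linear.has_vector_derivative[OF bounded_linear_snd der1[OF that]])
    ultimately have "(E has_vector_derivative transpose (A t) ** \<Sigma> ** (A t ** G (x t))
        + transpose (A t ** G (x t)) ** \<Sigma> ** A t - snd (V (x t))) (at t within {0..h1})"
      unfolding E_def by (rule has_vector_derivative_diff)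
    moreover have "transpose (A t) ** \<Sigma> ** (A t ** G (x t))
        + transpose (A t ** G (x t)) ** \<Sigma> ** A t - snd (V (x t)) = E' t"
      by (simp add: E'_def E_def V_def matrix_transpose_mul matrix_mul_assoc
          bounded_bilinear.diff_left[OF bb] bounded_bilinear.diff_right[OF bb])
    ultimately show ?thesis by simp
  qed
  obtain b where b: "\<And>\<theta>. \<theta> \<in> K \<Longrightarrow> norm (G \<theta>) \<le> b"
    using compact_imp_bounded[OF compact_continuous_image[OF lipschitz_on_continuous_on[OF G_lip] \<open>compact K\<close>]]
    by (auto simp: bounded_iff)
  obtain k1 where k1: "k1 > 0" "\<And>(X :: real^'v^'v) (Y :: real^'v^'v). norm (X ** Y) \<le> norm X * norm Y * k1"
    using bounded_bilinear.pos_bounded[OF bb] by blast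
  obtain k2 where k2: "k2 > 0" "\<And>(X :: real^'v^'v). norm (transpose X) \<le> norm X * k2"
    using bounded_linear.pos_bounded[OF bounded_linear_transpose] by blast
  have "norm (E' t) \<le> (b * k2 * k1 + b * k1) * norm (E t)" if "t \<in> {0..h1}" for t
  proof -
    have G_le: "norm (G (x t)) \<le> b" using b x_K[OF that] .
    then have "norm (transpose (G (x t))) \<le> b * k2"
      using k2 by (meson mult_right_mono order_trans less_imp_le)
    then have "norm (transpose (G (x t)) ** E t) \<le> b * k2 * norm (E t) * k1"
      using k1 by (meson mult_right_mono order_trans less_imp_le norm_ge_zero)
    moreover have "norm (E t ** G (x t)) \<le> norm (E t) * b * k1"
      using k1 G_le by (meson mult_left_mono mult_right_mono order_trans less_imp_le norm_ge_zero)
    ultimately have "norm (E' t) \<le> b * k2 * norm (E t) * k1 + norm (E t) * b * k1"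
      unfolding E'_def by (rule norm_triangle_mono)
    then show ?thesis by (simp add: algebra_simps)
  qed
  moreover have "E 0 = 0" using \<Sigma>[OF \<theta>0(1)] by (simp add: E_def A_def x0 \<Sigma>_def)
  ultimately obtain h2 where h2: "0 < h2" "h2 \<le> h1" "\<And>t. t \<in> {0..h2} \<Longrightarrow> E t = 0"
    using gronwall_zero[OF h1(1) _ E_der] by metis
  have fiber: "x ` {0..h2} \<subseteq> {\<theta>' \<in> Theta D B. phi \<theta>' = phi \<theta>0}"
  proof (rule image_subsetI)
    fix t assume t: "t \<in> {0..h2}"
    then have "x t \<in> Theta D B" using x_K[of t] K h2 by auto
    moreover from \<Sigma>[OF this] h2(3)[OF t] have "phi (x t) = phi \<theta>0"
      by (simp add: E_def A_def \<Sigma>_def)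
    ultimately show "x t \<in> {\<theta>' \<in> Theta D B. phi \<theta>' = phi \<theta>0}" by simp
  qed
  \<comment> \<open>A finite connected image is a single point. A constant curve would give
    \<open>V \<theta>0 = 0\<close>, hence \<open>G \<theta>0 = 0\<close> because
    \<open>I - \<Lambda>\<close> is invertible.\<close>
  have "infinite (x ` {0..h2})"
  proof
    assume fin: "finite (x ` {0..h2})"
    have "connected (x ` {0..h2})"
      using h2 h1 by (intro connected_continuous_image continuous_on_subset[OF x_cont]) auto
    with fin obtain a where "x ` {0..h2} = {a}"
      using connected_finite_iff_sing h2 by (metis atLeastatMost_empty_iff image_is_empty less_imp_le)
    then have const: "x t = \<theta>0" if "t \<in> {0..h2}" for t
      using x0 that h2(1) by (metis atLeastAtMost_iff image_eqI less_eq_real_def singletonD)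
    have zero: "0 \<in> {0..h2}" using h2 by simp
    have "(x has_vector_derivative 0) (at 0 within {0..h2})"
      by (rule has_vector_derivative_transform[OF zero const has_vector_derivative_const])
    moreover have "(x has_vector_derivative V \<theta>0) (at 0 within {0..h2})"
      using has_vector_derivative_within_subset[OF der1, of 0 "{0..h2}"] h1 h2 x0 by auto
    ultimately have "V \<theta>0 = 0"
      using vector_derivative_unique_within_closed_interval[of 0 h2 0 x] h2 by auto
    then have AG: "(mat 1 - fst \<theta>0) ** G \<theta>0 = 0" by (simp add: V_def zero_prod_def)
    have "invertible (mat 1 - fst \<theta>0)" using \<theta>0 by (simp add: Theta_iff)
    then have "G \<theta>0 = matrix_inv (mat 1 - fst \<theta>0) ** ((mat 1 - fst \<theta>0) ** G \<theta>0)"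
      by (simp add: matrix_mul_assoc matrix_inv)
    then show False using AG \<theta>0(2) bounded_bilinear.zero_right[OF bb] by metis
  qed
  then show ?thesis using fiber finite_subset by blast
qed

subsection \<open>Polynomial tangent fields\<close>

text \<open>The linear conditions on \<open>G\<close> that make \<open>(-(I - \<Lambda>) G, \<Omega> G + G\<^sup>T \<Omega>)\<close> tangent to \<open>Theta D B\<close>:
  the equation \<open>Inl (k,v)\<close> is the \<open>(k,v)\<close>-entry of \<open>(I - \<Lambda>) G\<close>, and \<open>Inr {u,v}\<close> is the
  \<open>(u,v)\<close>-entry of \<open>\<Omega> G + G\<^sup>T \<Omega>\<close>.  The unknown \<open>(k,v)\<close> is the entry \<open>G $ k $ v\<close>.\<close>

definition tangency_eqs ::
    "('v::finite \<times> 'v) set \<Rightarrow> ('v \<times> 'v) set \<Rightarrow> (('v \<times> 'v) + 'v set) set" where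
  "tangency_eqs D B = Inl ` (- D) \<union> Inr ` {{u,v} |u v. u \<noteq> v \<and> (u,v) \<notin> B}"

text \<open>For \<open>e = {u,v}\<close> with \<open>u \<noteq> v\<close>,
  \<open>the_elem (e - {v})\<close> is the other endpoint \<open>u\<close>, so the coefficient of
  \<open>G $ k $ v\<close> is \<open>\<Omega> $ u $ k\<close>. Unordered pairs make the two
  symmetric entries one equation.\<close>

definition tangency_coeff ::
    "'v::finite \<times> 'v \<Rightarrow> ('v \<times> 'v) + 'v set \<Rightarrow> (real^'v^'v) \<times> (real^'v^'v) \<Rightarrow> real" where
  "tangency_coeff i j = (case i of (k,v) \<Rightarrow> (case j of
       Inl (k',w) \<Rightarrow> (\<lambda>\<theta>. if w = v then (mat 1 - fst \<theta>) $ k' $ k else 0)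
     | Inr e \<Rightarrow> (\<lambda>\<theta>. if v \<in> e then snd \<theta> $ the_elem (e - {v}) $ k else 0)))"

lemma tangency_coeff_poly_fun: "tangency_coeff i j \<in> poly_fun"
proof -
  have if_in: "(\<lambda>\<theta>. if P then f \<theta> else 0) \<in> poly_fun" if "f \<in> poly_fun" for P f
    using that poly_fun.const by (cases P) auto
  have lin: "(\<lambda>\<theta>. (mat 1 - fst \<theta>) $ k' $ k) \<in> poly_fun" for k k' :: 'a
    unfolding vector_minus_component by (intro poly_fun_intros)
  show ?thesis
    by (cases j) (simp_all only: tangency_coeff_def case_prod_beta sum.case if_in lin poly_fun_snd)
qed

lemma sum_prod_delta_snd:
  fixes f :: "'a::finite \<times> 'b::finite \<Rightarrow> real"
  shows "(\<Sum>i\<in>UNIV. if snd i = v then f i else 0) = (\<Sum>k\<in>UNIV. f (k, v))"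
proof -
  have "(\<Sum>i\<in>UNIV. if snd i = v then f i else 0) = (\<Sum>k\<in>UNIV. \<Sum>w\<in>UNIV. if w = v then f (k, w) else 0)"
    unfolding UNIV_Times_UNIV[symmetric] sum.cartesian_product by (intro sum.cong) auto
  then show ?thesis by simp
qed

lemma tangency_Inl:
  "(\<Sum>i\<in>UNIV. c i * tangency_coeff i (Inl (k,v)) \<theta>) =
    ((mat 1 - fst \<theta>) ** (\<chi> k v. c (k,v))) $ k $ v"
proof -
  have "(\<Sum>i\<in>UNIV. c i * tangency_coeff i (Inl (k,v)) \<theta>) =
      (\<Sum>i\<in>UNIV. if snd i = v then c i * (mat 1 - fst \<theta>) $ k $ fst i else 0)"
    by (intro sum.cong) (auto simp: tangency_coeff_def)
  then show ?thesis by (simp add: sum_prod_delta_snd matrix_matrix_mult_def mult.commute)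
qed

lemma tangency_Inr:
  fixes u v :: "'v::finite"
  assumes "u \<noteq> v" "transpose (snd \<theta>) = snd \<theta>"
  shows "(\<Sum>i\<in>UNIV. c i * tangency_coeff i (Inr {u,v}) \<theta>) =
    (snd \<theta> ** (\<chi> k v. c (k,v)) + transpose (\<chi> k v. c (k,v)) ** snd \<theta>) $ u $ v"
proof -
  have the: "the_elem ({u,v} - {u}) = v" "the_elem ({u,v} - {v}) = u"
    using assms(1) by (simp_all add: insert_Diff_if)
  have sym: "snd \<theta> $ i $ j = snd \<theta> $ j $ i" for i j
    using arg_cong[OF assms(2), of "\<lambda>A. A $ j $ i"] by (simp add: transpose_def)
  have "(\<Sum>i\<in>UNIV. c i * tangency_coeff i (Inr {u,v}) \<theta>) =
      (\<Sum>i\<in>UNIV. (if snd i = v then c i * snd \<theta> $ u $ fst i else 0)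
        + (if snd i = u then c i * snd \<theta> $ v $ fst i else 0))"
  proof (intro sum.cong refl)
    fix i :: "'v \<times> 'v"
    obtain k w where i: "i = (k,w)" by (cases i)
    \<comment> \<open>Unknowns in column \<open>v\<close> enter through \<open>\<Omega> G\<close>,
      those in column \<open>u\<close> through its transpose; \<open>u \<noteq> v\<close> keeps the
      two apart.\<close>
    have "tangency_coeff i (Inr {u,v}) \<theta> =
        (if w = v then snd \<theta> $ u $ k else 0) + (if w = u then snd \<theta> $ v $ k else 0)"
    proof -
      consider "w = v" "w \<noteq> u" | "w = u" "w \<noteq> v" | "w \<noteq> u" "w \<noteq> v" using assms(1) by blast
      then show ?thesis
        by cases (simp_all only: i tangency_coeff_def prod.case sum.case the if_True if_False
            insert_iff empty_iff simp_thms add_0 add_0_right)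
    qed
    then show "c i * tangency_coeff i (Inr {u,v}) \<theta> =
        (if snd i = v then c i * snd \<theta> $ u $ fst i else 0)
        + (if snd i = u then c i * snd \<theta> $ v $ fst i else 0)"
      using i by (simp add: distrib_left)
  qed
  also have "\<dots> = (\<Sum>k\<in>UNIV. c (k,v) * snd \<theta> $ u $ k) + (\<Sum>k\<in>UNIV. c (k,u) * snd \<theta> $ v $ k)"
    by (simp add: sum.distrib sum_prod_delta_snd)
  also have "\<dots> = (\<Sum>k\<in>UNIV. snd \<theta> $ u $ k * c (k,v)) + (\<Sum>k\<in>UNIV. c (k,u) * snd \<theta> $ k $ v)"
    by (intro arg_cong2[where f = "(+)"] sum.cong refl) (rule mult.commute, subst sym, rule refl)
  finally show ?thesis
    by (simp add: matrix_matrix_mult_def transpose_def)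
qed

text \<open>A coefficient that is nonzero somewhere on \<open>Theta D B\<close> reveals an edge or a
  coincidence of vertices: off the diagonal, \<open>I - \<Lambda>\<close> is supported on
  \<open>D\<close> and \<open>\<Omega>\<close> on \<open>B\<close>.\<close>

lemma transversal_tangency_imp_HTC_family:
  assumes "sym B" "inj \<tau>" and eqs: "\<And>i. \<tau> i \<in> tangency_eqs D B"
    and nz: "\<And>i. \<exists>\<theta>\<in>Theta D B. tangency_coeff i (\<tau> i) \<theta> \<noteq> 0"
  shows "\<exists>Y. (\<forall>v. HTC D B (Y v) v) \<and> (\<forall>v w. v \<noteq> w \<longrightarrow> v \<in> Y w \<longrightarrow> w \<notin> Y v)"
proof (rule transversal_imp_HTC_family[OF \<open>inj \<tau>\<close>])
  fix k v k' w assume eq: "\<tau> (k,v) = Inl (k',w)"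
  obtain \<theta> where \<theta>: "\<theta> \<in> Theta D B" "tangency_coeff (k,v) (Inl (k',w)) \<theta> \<noteq> 0"
    using nz[of "(k,v)"] eq by auto
  then have "w = v" "(mat 1 - fst \<theta>) $ k' $ k \<noteq> 0"
    by (auto simp: tangency_coeff_def split: if_splits)
  moreover have "(k',w) \<notin> D" using eqs[of "(k,v)"] eq by (auto simp: tangency_eqs_def)
  moreover have "fst \<theta> $ k' $ k = 0" if "(k',k) \<notin> D"
    using \<theta>(1) that by (auto simp: Theta_def)
  then have "k' = k \<or> (k',k) \<in> D"
    using \<open>(mat 1 - fst \<theta>) $ k' $ k \<noteq> 0\<close> by (auto simp: mat_def split: if_splits)
  ultimately show "w = v \<and> (k',v) \<notin> D \<and> (k' = k \<or> (k',k) \<in> D)" by simp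
next
  fix k v e assume eq: "\<tau> (k,v) = Inr e"
  obtain \<theta> where \<theta>: "\<theta> \<in> Theta D B" "tangency_coeff (k,v) (Inr e) \<theta> \<noteq> 0"
    using nz[of "(k,v)"] eq by auto
  then have "v \<in> e" and nz: "snd \<theta> $ the_elem (e - {v}) $ k \<noteq> 0"
    by (auto simp: tangency_coeff_def split: if_splits)
  moreover have "\<exists>a b. e = {a,b} \<and> a \<noteq> b \<and> (a,b) \<notin> B"
    using eqs[of "(k,v)"] eq by (auto simp: tangency_eqs_def)
  \<comment> \<open>Symmetry of \<open>B\<close> allows \<open>v\<close> to be written second,
    whichever of \<open>a\<close> and \<open>b\<close> it is.\<close>
  ultimately obtain u where u: "e = {u,v}" "u \<noteq> v" "(u,v) \<notin> B"
    using \<open>sym B\<close> by (auto simp: insert_commute dest: symD)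
  then have "the_elem (e - {v}) = u" by (simp add: insert_Diff_if)
  then have "snd \<theta> $ u $ k \<noteq> 0" using nz by simp
  moreover have "snd \<theta> $ u $ k = 0" if "u \<noteq> k" "(u,k) \<notin> B"
    using \<theta>(1) that by (auto simp: Theta_def)
  ultimately have "u = k \<or> (u,k) \<in> B" by blast
  then show "\<exists>u. e = {u,v} \<and> u \<noteq> v \<and> (u,v) \<notin> B \<and> (u = k \<or> (u,k) \<in> B)" using u by blast
qed

theorem mainTheorem2:
  fixes D B :: "('v::finite \<times> 'v) set"
  assumes "mixed_graph D B"
    and "\<forall>Y :: 'v \<Rightarrow> 'v set.
           (\<exists>v. \<not> HTC D B (Y v) v) \<or> (\<exists>v w. v \<noteq> w \<and> v \<in> Y w \<and> w \<in> Y v)"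
  shows "generically_infinite_to_one D B"
proof -
  have "sym B" using assms(1) by (simp add: mixed_graph_def)
  let ?transversal = "\<lambda>\<tau>. inj \<tau> \<and> (\<forall>i\<in>UNIV. \<tau> i \<in> tangency_eqs D B \<and>
      (\<exists>\<theta>\<in>Theta D B. tangency_coeff i (\<tau> i) \<theta> \<noteq> 0))"
  let ?kernel = "\<lambda>c. (\<forall>i. c i \<in> poly_fun) \<and> (\<exists>i\<in>UNIV. \<exists>\<theta>\<in>Theta D B. c i \<theta> \<noteq> 0) \<and>
      (\<forall>j\<in>tangency_eqs D B. \<forall>\<theta>\<in>Theta D B. (\<Sum>i\<in>UNIV. c i \<theta> * tangency_coeff i j \<theta>) = 0)"
  have "\<not> ?transversal \<tau>" for \<tau>
  proof
    assume \<tau>: "?transversal \<tau>"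
    have "\<exists>Y. (\<forall>v. HTC D B (Y v) v) \<and> (\<forall>v w. v \<noteq> w \<longrightarrow> v \<in> Y w \<longrightarrow> w \<notin> Y v)"
      by (rule transversal_tangency_imp_HTC_family[OF \<open>sym B\<close>, of \<tau>]) (use \<tau> in blast)+
    then obtain Y where Y: "\<And>v. HTC D B (Y v) v" "\<And>v w. v \<noteq> w \<Longrightarrow> v \<in> Y w \<Longrightarrow> w \<notin> Y v"
      by blast
    then show False using spec[OF assms(2), of Y] by blast
  qed
  \<comment> \<open>Rows are the unknown entries of \<open>G\<close> and columns the tangency
    equations, so a kernel vector is a polynomial matrix solving all of them on
    \<open>Theta D B\<close>.\<close>
  moreover have "(\<exists>\<tau>. ?transversal \<tau>) \<or> (\<exists>c. ?kernel c)"
    by (rule kernel_or_transversal[where F = poly_fun, OF poly_fun.const poly_fun.add poly_fun.mult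
          Theta_nonempty poly_fun_mult_nonzero tangency_coeff_poly_fun]) simp_all
  ultimately obtain c where "?kernel c" by blast
  then have c: "\<And>i. c i \<in> poly_fun" and nz: "\<exists>i. \<exists>\<theta>\<in>Theta D B. c i \<theta> \<noteq> 0"
    and ker: "\<And>j \<theta>. \<lbrakk>j \<in> tangency_eqs D B; \<theta> \<in> Theta D B\<rbrakk>
      \<Longrightarrow> (\<Sum>i\<in>UNIV. c i \<theta> * tangency_coeff i j \<theta>) = 0"
    by blast+
  define G where "G \<theta> = (\<chi> k v. c (k,v) \<theta>)" for \<theta>
  have ker1: "((mat 1 - fst \<theta>) ** G \<theta>) $ k $ v = 0"
    if "\<theta> \<in> Theta D B" "(k,v) \<notin> D" for \<theta> k v
    using ker[of "Inl (k,v)" \<theta>] that tangency_Inl[of "\<lambda>i. c i \<theta>" k v \<theta>]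
    by (simp add: G_def tangency_eqs_def)
  have ker2: "(snd \<theta> ** G \<theta> + transpose (G \<theta>) ** snd \<theta>) $ u $ v = 0"
    if "\<theta> \<in> Theta D B" "u \<noteq> v" "(u,v) \<notin> B" for \<theta> u v
  proof -
    have "transpose (snd \<theta>) = snd \<theta>" using that(1) by (simp add: Theta_iff pos_def_mat_def)
    moreover have "Inr {u,v} \<in> tangency_eqs D B" using that by (auto simp: tangency_eqs_def)
    ultimately show ?thesis
      using ker[of "Inr {u,v}" \<theta>] that tangency_Inr[of u v \<theta> "\<lambda>i. c i \<theta>"] by (simp add: G_def)
  qed
  \<comment> \<open>The exceptional set is the common zero set of the entries of \<open>G\<close>;
    \<open>nz\<close> makes it proper, and outside it \<open>G \<theta> \<noteq> 0\<close>.\<close>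
  have "infinite {\<theta>' \<in> Theta D B. phi \<theta>' = phi \<theta>}"
    if "\<theta> \<in> Theta D B" "\<not> (\<forall>p\<in>range c. p \<theta> = 0)" for \<theta>
  proof (rule infinite_fiber[OF _ ker1 ker2 that(1)])
    show "(\<lambda>\<theta>. G \<theta> $ k $ v) \<in> poly_fun" for k v using c by (simp add: G_def)
    show "G \<theta> \<noteq> 0" using that(2) by (auto simp: G_def vec_eq_iff)
  qed
  moreover have "{\<theta> \<in> Theta D B. \<forall>p\<in>range c. p \<theta> = 0} \<noteq> Theta D B" using nz by auto
  ultimately show ?thesis
    unfolding generically_infinite_to_one_def using c by (intro exI[of _ "range c"]) auto
qed

end
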